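(* Let $\Pi\in\boldsymbol{\Pi}_{q,r}$ and $W\in\mathbb{R}^{q\times p}$, and define $\Pi_W:=\begin{bmatrix}W^\top\Pi_{11}W&W^\top\Pi_{12}\\ \Pi_{21}W&\Pi_{22}\end{bmatrix}\in\mathbb{S}^{p+r}$. Then $\mathcal{Z}_r(\Pi)W\subseteq\mathcal{Z}_r(\Pi_W)$. If, in addition, $W$ has full column rank or $\Pi_{22}$ is nonsingular, then $\mathcal{Z}_r(\Pi)W=\mathcal{Z}_r(\Pi_W)$.
   Context: $\mathbb{S}^k$ denotes the real symmetric $k\times k$ matrices; for symmetric matrices, $A\ge 0$ means positive semidefinite. $A^\dagger$ is the Moore–Penrose pseudo-inverse. Any $\Pi\in\mathbb{S}^{q+r}$ is partitioned as $\Pi=\begin{bmatrix}\Pi_{11}&\Pi_{12}\\ \Pi_{21}&\Pi_{22}\end{bmatrix}$ with $\Pi_{11}\in\mathbb{S}^q$, $\Pi_{22}\in\mathbb{S}^r$. The generalized Schur complement is $\Pi\mid\Pi_{22}:=\Pi_{11}-\Pi_{12}\Pi_{22}^\dagger\Pi_{21}$. The set $\boldsymbol{\Pi}_{q,r}$ consists of all $\Pi\in\mathbb{S}^{q+r}$ with $\Pi_{22}\le 0$, $\Pi\mid\Pi_{22}\ge 0$ and $\ker\Pi_{22}\subseteq\ker\Pi_{12}$. Define $\mathcal{Z}_r(\Pi)=\{Z\in\mathbb{R}^{r\times q}:\begin{bmatrix}I_q\\ Z\end{bmatrix}^\top\Pi\begin{bmatrix}I_q\\ Z\end{bmatrix}\ge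 0\}$ (and analogously $\mathcal{Z}_r(\Pi_W)\subseteq\mathbb{R}^{r\times p}$ with $I_p$). For a set $\mathcal{S}\subseteq\mathbb{R}^{r\times q}$, $\mathcal{S}W:=\{SW:S\in\mathcal{S}\}$. *)

theory Defs
  imports "HOL-Analysis.Analysis"
begin

text \<open>Positive semidefiniteness of a (symmetric) real square matrix.\<close>
definition psd :: "real^'n^'n \<Rightarrow> bool" where
  "psd A \<longleftrightarrow> transpose A = A \<and> (\<forall>x. 0 \<le> x \<bullet> (A *v x))"

definition nsd :: "real^'n^'n \<Rightarrow> bool" where
  "nsd A \<longleftrightarrow> psd (- A)"

definition symmetric_mat :: "real^'n^'n \<Rightarrow> bool" where
  "symmetric_mat A \<longleftrightarrow> transpose A = A"

text \<open>Moore--Penrose pseudo-inverse, via the four Penrose conditions.\<close>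
definition pinv :: "real^'n^'m \<Rightarrow> real^'m^'n" where
  "pinv A = (THE X. A ** X ** A = A \<and> X ** A ** X = X \<and>
                    transpose (A ** X) = A ** X \<and> transpose (X ** A) = X ** A)"

definition mker :: "real^'n^'m \<Rightarrow> (real^'n) set" where
  "mker A = {x. A *v x = 0}"

text \<open>Blocks of a matrix indexed by a sum type ('q + 'r).\<close>
definition blk11 :: "real^('q::finite+'r::finite)^('q+'r) \<Rightarrow> real^'q^'q" where
  "blk11 P = (\<chi> i j. P $ Inl i $ Inl j)"
definition blk12 :: "real^('q::finite+'r::finite)^('q+'r) \<Rightarrow> real^'r^'q" where
  "blk12 P = (\<chi> i j. P $ Inl i $ Inr j)"
definition blk21 :: "real^('q::finite+'r::finite)^('q+'r) \<Rightarrow> real^'q^'r" where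
  "blk21 P = (\<chi> i j. P $ Inr i $ Inl j)"
definition blk22 :: "real^('q::finite+'r::finite)^('q+'r) \<Rightarrow> real^'r^'r" where
  "blk22 P = (\<chi> i j. P $ Inr i $ Inr j)"

text \<open>Block matrix [A B; C D].\<close>
definition block_mat :: "real^'c^'a \<Rightarrow> real^'d^'a \<Rightarrow> real^'c^'b \<Rightarrow> real^'d^'b
    \<Rightarrow> real^('c::finite+'d::finite)^('a::finite+'b::finite)" where
  "block_mat A B C D = (\<chi> i j. (case i of
       Inl a \<Rightarrow> (case j of Inl c \<Rightarrow> A $ a $ c | Inr d \<Rightarrow> B $ a $ d)
     | Inr b \<Rightarrow> (case j of Inl c \<Rightarrow> C $ b $ c | Inr d \<Rightarrow> D $ b $ d)))"

text \<open>Generalized Schur complement  Pi | Pi22.\<close>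
definition schur22 :: "real^('q::finite+'r::finite)^('q+'r) \<Rightarrow> real^'q^'q" where
  "schur22 P = blk11 P - blk12 P ** pinv (blk22 P) ** blk21 P"

text \<open>The set  \<Pi>_{q,r}.\<close>
definition PiSet :: "(real^('q::finite+'r::finite)^('q+'r)) set" where
  "PiSet = {P. symmetric_mat P \<and> nsd (blk22 P) \<and> psd (schur22 P)
              \<and> mker (blk22 P) \<subseteq> mker (blk12 P)}"

text \<open>Stacked matrix [I; Z].\<close>
definition stackI :: "real^'q^'r \<Rightarrow> real^'q^('q+'r)" where
  "stackI Z = (\<chi> i. case i of Inl a \<Rightarrow> (mat 1 :: real^'q^'q) $ a | Inr b \<Rightarrow> Z $ b)"

text \<open>Z_r(Pi) = {Z :: r x q. [I;Z]^T Pi [I;Z] \<ge> 0}.\<close>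
definition Zset :: "real^('q::finite+'r::finite)^('q+'r) \<Rightarrow> (real^'q^'r) set" where
  "Zset P = {Z. psd (transpose (stackI Z) ** P ** stackI Z)}"

text \<open>Pi_W.\<close>
definition PiW :: "real^('q::finite+'r::finite)^('q+'r) \<Rightarrow> real^'p^'q \<Rightarrow> real^('p::finite+'r)^('p+'r)" where
  "PiW P W = block_mat (transpose W ** blk11 P ** W) (transpose W ** blk12 P)
                       (blk21 P ** W) (blk22 P)"

end

theory Submission
  imports Defs
begin

text \<open>Completing the square in the second block coordinate gives
  \<open>[x; z]\<^sup>T \<Pi> [x; z] = x\<^sup>T S x - (z + \<Pi>\<^sub>2\<^sub>2\<^sup>\<dagger> \<Pi>\<^sub>2\<^sub>1 x)\<^sup>T N (z + \<Pi>\<^sub>2\<^sub>2\<^sup>\<dagger> \<Pi>\<^sub>2\<^sub>1 x)\<close> with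
  \<open>S = \<Pi> | \<Pi>\<^sub>2\<^sub>2 \<ge> 0\<close> and \<open>N = -\<Pi>\<^sub>2\<^sub>2 \<ge> 0\<close>. Hence \<open>Z \<in> Zset \<Pi>\<close> iff
  \<open>F = Z + \<Pi>\<^sub>2\<^sub>2\<^sup>\<dagger> \<Pi>\<^sub>2\<^sub>1\<close> satisfies \<open>F\<^sup>T N F \<le> S\<close>, and \<open>Y \<in> Zset \<Pi>\<^sub>W\<close> iff
  \<open>E = Y + \<Pi>\<^sub>2\<^sub>2\<^sup>\<dagger> \<Pi>\<^sub>2\<^sub>1 W\<close> satisfies \<open>E\<^sup>T N E \<le> W\<^sup>T S W\<close>; the inclusion takes \<open>E = F W\<close>.
  Conversely, \<open>W H\<^sup>\<dagger> W\<^sup>T S\<close> with \<open>H = W\<^sup>T S W\<close> is the \<open>S\<close>-orthogonal projection onto the range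
  of \<open>W\<close>, so \<open>F = E (H\<^sup>\<dagger> W\<^sup>T S + K)\<close> satisfies \<open>F\<^sup>T N F \<le> S\<close> for every \<open>K\<close> with \<open>H K = 0\<close>;
  when \<open>W\<close> is injective or \<open>N\<close> is nonsingular, \<open>K\<close> can be chosen so that \<open>F W = E\<close>.\<close>

definition quad_form :: "real^'n^'n \<Rightarrow> real^'n \<Rightarrow> real" where
  "quad_form A x = x \<bullet> (A *v x)"

lemma inner_matrix_vector_transpose:
  fixes M :: "real^'n^'m"
  shows "(M *v x) \<bullet> y = x \<bullet> (transpose M *v y)"
  by (metis dot_lmul_matrix inner_commute vector_transpose_matrix)

lemma symmetric_inner_commute:
  fixes A :: "real^'n^'n"
  assumes "transpose A = A"
  shows "x \<bullet> (A *v y) = y \<bullet> (A *v x)"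
  by (metis assms inner_commute inner_matrix_vector_transpose)

lemma transpose_eq_if_self_adjoint:
  fixes A :: "real^'n^'n"
  assumes "\<And>x y. (A *v x) \<bullet> y = x \<bullet> (A *v y)"
  shows "transpose A = A"
proof -
  have "y \<bullet> (transpose A *v x) = y \<bullet> (A *v x)" for x y
    using inner_matrix_vector_transpose[of A y x] assms[of y x] by simp
  then show ?thesis
    unfolding matrix_eq by (blast intro: vector_eq_ldot[THEN iffD1])
qed

lemma matrix_vector_mult_uminus_left:
  fixes A :: "real^'n^'m"
  shows "(- A) *v x = - (A *v x)"
  by (simp add: vec_eq_iff matrix_vector_mult_def sum_negf)

lemma psd_quad_form_nonneg: "psd A \<Longrightarrow> 0 \<le> quad_form A x"
  by (simp add: psd_def quad_form_def)

lemma quad_form_diff: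
  fixes A :: "real^'n^'n"
  assumes "transpose A = A"
  shows "quad_form A (x - y) = quad_form A x - 2 * (y \<bullet> (A *v x)) + quad_form A y"
  using symmetric_inner_commute[OF assms, of x y]
  by (simp add: quad_form_def matrix_vector_mult_diff_distrib inner_diff_left inner_diff_right)

lemma quad_form_add_null:
  fixes A :: "real^'n^'n"
  assumes "transpose A = A" "A *v y = 0"
  shows "quad_form A (x + y) = quad_form A x"
  using assms symmetric_inner_commute[OF assms(1), of x y]
  by (simp add: quad_form_def matrix_vector_right_distrib inner_add_left inner_add_right)

text \<open>If \<open>q(b) = 0\<close>, then \<open>0 \<le> q(b - s A b) = s\<^sup>2 q(A b) - 2 s |A b|\<^sup>2\<close> for all \<open>s > 0\<close>,
  which forces \<open>A b = 0\<close>.\<close>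
lemma psd_mult_eq_0_if_quad_form_eq_0:
  fixes A :: "real^'n^'n"
  assumes "psd A" "quad_form A b = 0"
  shows "A *v b = 0"
proof -
  have sym: "transpose A = A" using assms(1) by (simp add: psd_def)
  define w where "w = A *v b"
  define s where "s = (w \<bullet> w) / (quad_form A w + 1)"
  have qw: "0 \<le> quad_form A w" using assms(1) by (rule psd_quad_form_nonneg)
  have "0 \<le> quad_form A (b - s *\<^sub>R w)" using assms(1) by (rule psd_quad_form_nonneg)
  also have "\<dots> = s * (s * quad_form A w) - 2 * s * (w \<bullet> w)"
    using assms(2)
    by (simp add: quad_form_diff[OF sym] w_def) (simp add: quad_form_def matrix_vector_mult_scaleR)
  finally have le: "2 * (s * (w \<bullet> w)) \<le> s * (s * quad_form A w)" by simp
  show ?thesis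
  proof (rule ccontr)
    assume "A *v b \<noteq> 0"
    then have ww: "0 < w \<bullet> w" by (simp add: w_def)
    then have s: "0 < s" using qw unfolding s_def by (intro divide_pos_pos) auto
    have "quad_form A w / (quad_form A w + 1) < 1" using qw by (subst divide_less_eq_1_pos) auto
    then have "(w \<bullet> w) * (quad_form A w / (quad_form A w + 1)) < (w \<bullet> w) * 1"
      using ww by (rule mult_strict_left_mono)
    then have "s * quad_form A w < w \<bullet> w" by (simp add: s_def)
    then have "s * (s * quad_form A w) < s * (w \<bullet> w)" using s by simp
    moreover have "0 < s * (w \<bullet> w)" using s ww by simp
    ultimately show False using le by linarith
  qed
qed

definition penrose_inverse :: "real^'n^'m \<Rightarrow> real^'m^'n \<Rightarrow> bool" where
  "penrose_inverse A X \<longleftrightarrow> A ** X ** A = A \<and> X ** A ** X = X \<and>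
     transpose (A ** X) = A ** X \<and> transpose (X ** A) = X ** A"

lemma penrose_inverse_unique:
  assumes "penrose_inverse A X" "penrose_inverse A Y"
  shows "X = Y"
proof -
  from assms have a1: "A ** X ** A = A" and a2: "X ** A ** X = X"
    and a3: "transpose (A ** X) = A ** X" and a4: "transpose (X ** A) = X ** A"
    and b1: "A ** Y ** A = A" and b2: "Y ** A ** Y = Y"
    and b3: "transpose (A ** Y) = A ** Y" and b4: "transpose (Y ** A) = Y ** A"
    by (auto simp: penrose_inverse_def)
  have "X = X ** transpose (A ** X)" using a2 a3 by (simp add: matrix_mul_assoc)
  also have "\<dots> = X ** transpose (A ** Y ** A ** X)" using b1 by simp
  also have "\<dots> = X ** (A ** X) ** (A ** Y)"
    using a3 b3 by (simp add: matrix_transpose_mul matrix_mul_assoc)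
  also have "\<dots> = X ** A ** Y" using a2 by (simp add: matrix_mul_assoc)
  finally have X: "X = X ** A ** Y" .
  have "Y = transpose (Y ** A) ** Y" using b2 b4 by (simp add: matrix_mul_assoc)
  also have "\<dots> = transpose (Y ** A ** X ** A) ** Y" by (metis a1 matrix_mul_assoc)
  also have "\<dots> = (X ** A) ** (Y ** A) ** Y"
    using a4 b4 by (simp add: matrix_transpose_mul matrix_mul_assoc)
  also have "\<dots> = X ** A ** Y" by (metis b2 matrix_mul_assoc)
  finally show ?thesis using X by simp
qed

lemma pinv_eq_if_penrose_inverse: "penrose_inverse A X \<Longrightarrow> pinv A = X"
  unfolding pinv_def
  by (rule the_equality) (auto simp: penrose_inverse_def intro: penrose_inverse_unique)

lemma symmetric_range_orthogonal_kernel: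
  fixes A :: "real^'n^'n"
  assumes "transpose A = A" "A *v z = 0"
  shows "(A *v u) \<bullet> z = 0"
  using assms inner_matrix_vector_transpose[of A u z] by simp

lemma symmetric_range_kernel_decomp:
  fixes A :: "real^'n^'n"
  assumes sym: "transpose A = A"
  obtains y z where "y \<in> range ((*v) A)" "A *v z = 0" "x = y + z"
proof -
  obtain y z where y: "y \<in> span (range ((*v) A))" and xyz: "x = y + z"
    and z: "\<And>w. w \<in> span (range ((*v) A)) \<Longrightarrow> orthogonal z w"
    using orthogonal_subspace_decomp_exists by blast
  have R: "span (range ((*v) A)) = range ((*v) A)"
    by (simp add: span_eq_iff linear_subspace_image matrix_vector_mul_linear)
  have "y \<in> range ((*v) A)" using y unfolding R .
  have "orthogonal z (A *v (A *v z))" using z unfolding R by blast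
  then have "(A *v z) \<bullet> (A *v z) = 0"
    using sym inner_matrix_vector_transpose[of A z "A *v z"] by (simp add: orthogonal_def)
  then show thesis using that \<open>y \<in> range ((*v) A)\<close> xyz by simp
qed

lemma symmetric_range_left_inverse:
  fixes A :: "real^'n^'n"
  assumes sym: "transpose A = A"
  obtains g where "linear g" "\<And>y. g y \<in> range ((*v) A)"
    "\<And>y. y \<in> range ((*v) A) \<Longrightarrow> g (A *v y) = y"
    "\<And>y. y \<in> range ((*v) A) \<Longrightarrow> A *v g y = y"
proof -
  define V where "V = range ((*v) A)"
  have spanV: "span V = V"
    by (simp add: V_def span_eq_iff linear_subspace_image matrix_vector_mul_linear)
  have "inj_on ((*v) A) (span V)"
  proof (rule inj_onI)
    fix x y assume "x \<in> span V" "y \<in> span V" "A *v x = A *v y"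
    then have "x - y \<in> V" "A *v (x - y) = 0"
      using span_diff[of x V y] by (simp_all add: spanV matrix_vector_mult_diff_distrib)
    then obtain u where "x - y = A *v u" "A *v (x - y) = 0" by (auto simp: V_def)
    then show "x = y"
      using symmetric_range_orthogonal_kernel[OF sym, of "x - y" u] by simp
  qed
  then obtain g where g_range: "range g \<subseteq> V" and g_linear: "linear g"
    and g_inverse: "\<And>y. y \<in> V \<Longrightarrow> g (A *v y) = y"
    using linear_inj_on_left_inverse[OF matrix_vector_mul_linear] spanV by metis
  have "A *v g y = y" if "y \<in> V" for y
  proof -
    obtain u where u: "y = A *v u" using \<open>y \<in> V\<close> by (auto simp: V_def)
    obtain u1 u2 where "u1 \<in> V" "A *v u2 = 0" "u = u1 + u2"
      using symmetric_range_kernel_decomp[OF sym] V_def by blast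
    then show ?thesis using u g_inverse by (simp add: matrix_vector_right_distrib)
  qed
  moreover have "g y \<in> V" for y
    using g_range by blast
  ultimately show thesis
    using that g_linear g_inverse V_def by blast
qed

text \<open>With \<open>g\<close> a linear inverse of \<open>A\<close> on its range, \<open>P = g A\<close> is the orthogonal projection
  onto the range, and \<open>X = g P\<close> satisfies the Penrose conditions with \<open>A X = X A = P\<close>.\<close>
lemma penrose_inverse_exists_symmetric:
  fixes A :: "real^'n^'n"
  assumes sym: "transpose A = A"
  shows "\<exists>X. penrose_inverse A X"
proof -
  define V where "V = range ((*v) A)"
  obtain g where g_linear: "linear g" and g_in_V: "\<And>y. g y \<in> V"
    and g_inverse: "\<And>y. y \<in> V \<Longrightarrow> g (A *v y) = y" and A_g: "\<And>y. y \<in> V \<Longrightarrow> A *v g y = y"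
    using symmetric_range_left_inverse[OF sym] V_def by blast
  define P where "P = matrix g ** A"
  have gv: "matrix g *v y = g y" for y by (simp add: g_linear matrix_works)
  have P_decomp: "P *v (y + z) = y" if "y \<in> V" "A *v z = 0" for y z
    using that g_inverse by (simp add: P_def gv matrix_vector_right_distrib
        matrix_vector_mul_assoc[symmetric])
  have P_range: "P *v y = y" if "y \<in> V" for y
    using P_decomp[OF that, of 0] by simp
  have "transpose P = P"
  proof (rule transpose_eq_if_self_adjoint)
    fix x x'
    obtain y z where "y \<in> V" "A *v z = 0" "x = y + z"
      using symmetric_range_kernel_decomp[OF sym] V_def by blast
    moreover obtain y' z' where "y' \<in> V" "A *v z' = 0" "x' = y' + z'"
      using symmetric_range_kernel_decomp[OF sym] V_def by blast
    ultimately show "(P *v x) \<bullet> x' = x \<bullet> (P *v x')"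
      using symmetric_range_orthogonal_kernel[OF sym]
      by (auto simp: P_decomp V_def inner_add_left inner_add_right inner_commute)
  qed
  define X where "X = matrix g ** P"
  have P_in_V: "P *v x \<in> V" for x
    by (simp add: P_def gv g_in_V matrix_vector_mul_assoc[symmetric])
  have AX: "A ** X = P"
    by (simp add: matrix_eq X_def gv A_g P_in_V matrix_vector_mul_assoc[symmetric])
  have XA: "X ** A = P"
  proof (rule matrix_eq[THEN iffD2], rule allI)
    fix x
    have "(X ** A) *v x = g (P *v (A *v x))"
      by (simp add: X_def gv matrix_vector_mul_assoc[symmetric])
    also have "\<dots> = g (A *v x)" using P_range by (simp add: V_def)
    also have "\<dots> = P *v x" by (simp add: P_def gv matrix_vector_mul_assoc[symmetric])
    finally show "(X ** A) *v x = P *v x" .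
  qed
  have "penrose_inverse A X"
    unfolding penrose_inverse_def
  proof (intro conjI)
    show "A ** X ** A = A"
      by (simp add: AX matrix_eq matrix_vector_mul_assoc[symmetric] P_range V_def)
    have "P ** X = X"
      by (simp add: X_def matrix_eq gv g_in_V P_range matrix_vector_mul_assoc[symmetric])
    then show "X ** A ** X = X" by (simp add: XA)
  qed (simp_all add: AX XA \<open>transpose P = P\<close>)
  then show ?thesis ..
qed

lemma penrose_inverse_pinv_symmetric:
  fixes A :: "real^'n^'n"
  assumes "transpose A = A"
  shows "penrose_inverse A (pinv A)"
  using penrose_inverse_exists_symmetric[OF assms] pinv_eq_if_penrose_inverse by blast

lemma pinv_symmetric:
  fixes A :: "real^'n^'n"
  assumes sym: "transpose A = A"
  shows "A ** pinv A ** A = A" "pinv A ** A ** pinv A = pinv A" "transpose (pinv A) = pinv A"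
proof -
  note P = penrose_inverse_pinv_symmetric[OF sym, unfolded penrose_inverse_def]
  show "A ** pinv A ** A = A" "pinv A ** A ** pinv A = pinv A" using P by simp_all
  have "penrose_inverse A (transpose (pinv A))"
    using P sym unfolding penrose_inverse_def
    by (metis matrix_transpose_mul matrix_mul_assoc transpose_transpose)
  then show "transpose (pinv A) = pinv A"
    by (rule pinv_eq_if_penrose_inverse[symmetric])
qed

lemma kernel_subset_imp_mult_pinv_mult:
  fixes A :: "real^'n^'n" and B :: "real^'n^'m"
  assumes "transpose A = A" "mker A \<subseteq> mker B"
  shows "B ** pinv A ** A = B"
proof -
  have "A *v (x - (pinv A ** A) *v x) = 0" for x
    using pinv_symmetric(1)[OF assms(1)]
    by (simp add: matrix_vector_mult_diff_distrib matrix_vector_mul_assoc matrix_mul_assoc)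
  then have "B *v (x - (pinv A ** A) *v x) = 0" for x
    using assms(2) by (auto simp: mker_def)
  then show ?thesis
    by (simp add: matrix_eq matrix_vector_mult_diff_distrib matrix_vector_mul_assoc matrix_mul_assoc)
qed

lemma sum_UNIV_Plus:
  fixes f :: "('a::finite + 'b::finite) \<Rightarrow> real"
  shows "(\<Sum>i\<in>UNIV. f i) = (\<Sum>a\<in>UNIV. f (Inl a)) + (\<Sum>b\<in>UNIV. f (Inr b))"
  by (subst UNIV_Plus_UNIV[symmetric], subst sum.Plus) (auto simp: comp_def)

definition vec_join :: "real^'q \<Rightarrow> real^'r \<Rightarrow> real^('q + 'r)" where
  "vec_join x z = (\<chi> i. case i of Inl a \<Rightarrow> x $ a | Inr b \<Rightarrow> z $ b)"

lemma vec_join_nth [simp]: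
  "vec_join x z $ Inl a = x $ a" "vec_join x z $ Inr b = z $ b"
  by (simp_all add: vec_join_def)

lemma stackI_mult_vector:
  fixes Z :: "real^'q::finite^'r::finite"
  shows "stackI Z *v x = vec_join x (Z *v x)"
proof -
  have "(\<Sum>j\<in>UNIV. (mat 1 :: real^'q^'q) $ a $ j * x $ j) = x $ a" for a
    using matrix_vector_mul_lid[of x] unfolding matrix_vector_mult_def vec_eq_iff by simp
  then show ?thesis
    by (simp add: vec_eq_iff stackI_def vec_join_def matrix_vector_mult_def split: sum.splits)
qed

lemma quad_form_vec_join:
  fixes P :: "real^('q::finite + 'r::finite)^('q + 'r)"
  shows "quad_form P (vec_join x z) = quad_form (blk11 P) x + x \<bullet> (blk12 P *v z)
           + z \<bullet> (blk21 P *v x) + quad_form (blk22 P) z"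
  by (simp add: quad_form_def inner_vec_def matrix_vector_mult_def sum_UNIV_Plus
      blk11_def blk12_def blk21_def blk22_def sum.distrib sum_distrib_left algebra_simps)

lemma Zset_iff_quad_form:
  fixes P :: "real^('q::finite + 'r::finite)^('q + 'r)"
  assumes "transpose P = P"
  shows "Z \<in> Zset P \<longleftrightarrow> (\<forall>x. 0 \<le> quad_form P (vec_join x (Z *v x)))"
proof -
  have "transpose (transpose (stackI Z) ** P ** stackI Z) = transpose (stackI Z) ** P ** stackI Z"
    using assms by (simp add: matrix_transpose_mul matrix_mul_assoc)
  moreover have "quad_form (transpose (stackI Z) ** P ** stackI Z) x
      = quad_form P (vec_join x (Z *v x))" for x
    by (simp only: quad_form_def matrix_vector_mul_assoc[symmetric]
        inner_matrix_vector_transpose[symmetric] stackI_mult_vector)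
  ultimately show ?thesis by (simp add: Zset_def psd_def quad_form_def)
qed

lemma blk_block_mat [simp]:
  "blk11 (block_mat A B C D) = A" "blk12 (block_mat A B C D) = B"
  "blk21 (block_mat A B C D) = C" "blk22 (block_mat A B C D) = D"
  by (simp_all add: vec_eq_iff blk11_def blk12_def blk21_def blk22_def block_mat_def)

lemma transpose_block_mat:
  "transpose (block_mat A B C D) = block_mat (transpose A) (transpose C) (transpose B) (transpose D)"
  by (simp add: vec_eq_iff block_mat_def transpose_def split: sum.splits)

lemma transpose_blk_symmetric:
  fixes P :: "real^('q::finite + 'r::finite)^('q + 'r)"
  assumes "transpose P = P"
  shows "transpose (blk11 P) = blk11 P" "transpose (blk22 P) = blk22 P"
    "transpose (blk12 P) = blk21 P" "transpose (blk21 P) = blk12 P"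
proof -
  have "P $ i $ j = P $ j $ i" for i j
    using arg_cong[OF assms, of "\<lambda>M. M $ j $ i"] by (simp add: transpose_def)
  then show "transpose (blk11 P) = blk11 P" "transpose (blk22 P) = blk22 P"
    "transpose (blk12 P) = blk21 P" "transpose (blk21 P) = blk12 P"
    by (simp_all add: vec_eq_iff blk11_def blk12_def blk21_def blk22_def transpose_def)
qed

lemma transpose_PiW:
  fixes P :: "real^('q::finite + 'r::finite)^('q + 'r)"
  assumes "transpose P = P"
  shows "transpose (PiW P W) = PiW P W"
  using transpose_blk_symmetric[OF assms]
  by (simp add: PiW_def transpose_block_mat matrix_transpose_mul matrix_mul_assoc)

lemma quad_form_PiW_vec_join:
  fixes P :: "real^('q::finite + 'r::finite)^('q + 'r)"
  shows "quad_form (PiW P W) (vec_join v z) = quad_form P (vec_join (W *v v) z)"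
  unfolding quad_form_vec_join PiW_def blk_block_mat
  unfolding quad_form_def
  by (simp only: matrix_vector_mul_assoc[symmetric] inner_matrix_vector_transpose[symmetric])

text \<open>The kernel condition is what makes \<open>D D\<^sup>\<dagger> P\<^sub>2\<^sub>1 = P\<^sub>2\<^sub>1\<close> for \<open>D = P\<^sub>2\<^sub>2\<close>, so that the
  square can be completed.\<close>
lemma quad_form_vec_join_schur22:
  fixes P :: "real^('q::finite + 'r::finite)^('q + 'r)"
  assumes sym: "transpose P = P" and ker: "mker (blk22 P) \<subseteq> mker (blk12 P)"
  shows "quad_form P (vec_join x z) = quad_form (schur22 P) x
           - quad_form (- blk22 P) (z + (pinv (blk22 P) ** blk21 P) *v x)"
proof -
  define B where "B = blk12 P"
  define C where "C = blk21 P"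
  define D where "D = blk22 P"
  define w where "w = pinv D *v (C *v x)"
  note blk = transpose_blk_symmetric[OF sym, folded B_def C_def D_def]
  have "transpose (B ** pinv D ** D) = D ** transpose (pinv D) ** C"
    by (simp add: matrix_transpose_mul matrix_mul_assoc blk)
  then have "D ** pinv D ** C = C"
    using kernel_subset_imp_mult_pinv_mult[OF blk(2) ker[folded B_def D_def]]
      pinv_symmetric(3)[OF blk(2)] blk by simp
  then have Dw: "D *v w = C *v x"
    by (metis w_def matrix_vector_mul_assoc)
  have BC: "x \<bullet> (B *v y) = y \<bullet> (C *v x)" for y
    using inner_matrix_vector_transpose[of C x y] blk(4) by (simp add: inner_commute)
  have "quad_form (- D) (z + w) = - (quad_form D z + 2 * (z \<bullet> (C *v x)) + x \<bullet> (B *v w))"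
  proof -
    have "w \<bullet> (D *v z) = z \<bullet> (C *v x)"
      using symmetric_inner_commute[OF blk(2), of w z] Dw by simp
    moreover have "w \<bullet> (D *v w) = x \<bullet> (B *v w)"
      using Dw BC[of w] by simp
    ultimately show ?thesis
      using Dw by (simp add: quad_form_def matrix_vector_mult_uminus_left
          matrix_vector_right_distrib inner_add_left inner_add_right inner_diff_right)
  qed
  moreover have "quad_form (schur22 P) x = quad_form (blk11 P) x - x \<bullet> (B *v w)"
    by (simp add: schur22_def quad_form_def w_def B_def C_def D_def
        matrix_vector_mult_diff_rdistrib inner_diff_right matrix_vector_mul_assoc[symmetric]
        del: transpose_matrix_vector)
  moreover have "(pinv (blk22 P) ** blk21 P) *v x = w"
    by (simp add: w_def C_def D_def matrix_vector_mul_assoc)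
  ultimately show ?thesis
    using BC[of z] unfolding quad_form_vec_join B_def[symmetric] C_def[symmetric] D_def[symmetric]
    by simp
qed

lemma Zset_iff_schur22:
  fixes P :: "real^('q::finite + 'r::finite)^('q + 'r)"
  assumes "P \<in> PiSet"
  shows "Z \<in> Zset P \<longleftrightarrow> (\<forall>x. quad_form (- blk22 P) (Z *v x + (pinv (blk22 P) ** blk21 P) *v x)
           \<le> quad_form (schur22 P) x)"
proof -
  have "transpose P = P" "mker (blk22 P) \<subseteq> mker (blk12 P)"
    using assms by (simp_all add: PiSet_def symmetric_mat_def)
  then show ?thesis
    by (simp add: Zset_iff_quad_form quad_form_vec_join_schur22)
qed

lemma Zset_PiW_iff_schur22:
  fixes P :: "real^('q::finite + 'r::finite)^('q + 'r)"
  assumes "P \<in> PiSet"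
  shows "Y \<in> Zset (PiW P W) \<longleftrightarrow> (\<forall>v. quad_form (- blk22 P) (Y *v v + (pinv (blk22 P) ** blk21 P) *v (W *v v))
           \<le> quad_form (schur22 P) (W *v v))"
proof -
  have "transpose P = P" "mker (blk22 P) \<subseteq> mker (blk12 P)"
    using assms by (simp_all add: PiSet_def symmetric_mat_def)
  then show ?thesis
    by (simp add: Zset_iff_quad_form transpose_PiW quad_form_PiW_vec_join quad_form_vec_join_schur22)
qed

lemma quad_form_congruence:
  fixes S :: "real^'q^'q" and W :: "real^'p^'q"
  shows "quad_form (transpose W ** S ** W) v = quad_form S (W *v v)"
  by (simp add: quad_form_def inner_matrix_vector_transpose matrix_vector_mul_assoc[symmetric]
      del: transpose_matrix_vector)

lemma psd_congruence_kernel: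
  fixes S :: "real^'q^'q" and W :: "real^'p^'q"
  assumes "psd S" "(transpose W ** S ** W) *v c = 0"
  shows "S *v (W *v c) = 0"
  using assms psd_mult_eq_0_if_quad_form_eq_0
  by (metis quad_form_congruence quad_form_def inner_zero_right)

text \<open>\<open>W H\<^sup>\<dagger> W\<^sup>T S\<close>, with \<open>H = W\<^sup>T S W\<close>, is the \<open>S\<close>-orthogonal projection onto the range of
  \<open>W\<close>, and adding a vector of the kernel of \<open>H\<close> does not change its \<open>S\<close>-length.\<close>
lemma quad_form_congruence_projection_le:
  fixes S :: "real^'q^'q" and W :: "real^'p^'q"
  assumes S: "psd S" and c: "(transpose W ** S ** W) *v c = 0"
  shows "quad_form S (W *v (pinv (transpose W ** S ** W) *v (transpose W *v (S *v x)) + c))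
           \<le> quad_form S x"
proof -
  define H where "H = transpose W ** S ** W"
  define u where "u = transpose W *v (S *v x)"
  define a where "a = W *v (pinv H *v u)"
  have symS: "transpose S = S" using S by (simp add: psd_def)
  have symH: "transpose H = H" by (simp add: H_def matrix_transpose_mul matrix_mul_assoc symS)
  note pH = pinv_symmetric[OF symH]
  have "quad_form S (W *v (pinv H *v u + c)) = quad_form S a"
    using quad_form_add_null[OF symS psd_congruence_kernel[OF S c]]
    by (simp add: a_def matrix_vector_right_distrib)
  moreover have "quad_form S a = u \<bullet> (pinv H *v u)"
  proof -
    have "quad_form S a = quad_form H (pinv H *v u)"
      by (simp only: a_def H_def quad_form_congruence)
    also have "\<dots> = (pinv H *v u) \<bullet> (H *v (pinv H *v u))"
      by (simp only: quad_form_def)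
    also have "\<dots> = u \<bullet> (pinv H *v (H *v (pinv H *v u)))"
      by (simp add: inner_matrix_vector_transpose pH(3))
    also have "\<dots> = u \<bullet> (pinv H *v u)"
      by (metis pH(2) matrix_vector_mul_assoc)
    finally show ?thesis .
  qed
  moreover have "a \<bullet> (S *v x) = u \<bullet> (pinv H *v u)"
    using inner_matrix_vector_transpose[of "pinv H" u u] pH(3)
    by (simp add: a_def u_def inner_matrix_vector_transpose inner_commute del: transpose_matrix_vector)
  moreover have "0 \<le> quad_form S (x - a)"
    using S by (rule psd_quad_form_nonneg)
  ultimately show ?thesis
    by (simp add: quad_form_diff[OF symS] H_def u_def)
qed

text \<open>In general dominance only gives \<open>N E d = 0\<close> on the kernel of \<open>W\<close>, whereas \<open>F W = E\<close>
  forces \<open>E d = 0\<close> there; the nondegeneracy hypothesis bridges this gap.\<close>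
lemma psd_dominated_factor_extends:
  fixes S :: "real^'q^'q" and N :: "real^'r^'r" and W :: "real^'p^'q" and E :: "real^'p^'r"
  assumes S: "psd S" and N: "psd N"
    and dom: "\<And>v. quad_form N (E *v v) \<le> quad_form S (W *v v)"
    and nondeg: "rank W = CARD('p) \<or> invertible N"
  obtains F where "F ** W = E" "\<And>x. quad_form N (F *v x) \<le> quad_form S x"
proof -
  define H where "H = transpose W ** S ** W"
  have HHH: "H *v (pinv H *v (H *v y)) = H *v y" for y
    using pinv_symmetric(1)[of H] S
    by (simp add: H_def psd_def matrix_transpose_mul matrix_mul_assoc matrix_vector_mul_assoc)
  obtain K :: "real^'q^'p" where HK: "\<And>y. H *v (K *v y) = 0"
    and EK: "\<And>v. E *v (pinv H *v (H *v v) + K *v (W *v v)) = E *v v"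
  proof (cases "rank W = CARD('p)")
    case True
    then obtain L :: "real^'q^'p" where "L ** W = mat 1"
      using full_rank_injective matrix_left_invertible_injective by blast
    then have LW: "L *v (W *v v) = v" for v
      by (simp add: matrix_vector_mul_assoc)
    show thesis
    proof (rule that[of "(mat 1 - pinv H ** H) ** L"])
      show "H *v (((mat 1 - pinv H ** H) ** L) *v y) = 0" for y
        by (simp add: HHH matrix_vector_mul_assoc[symmetric] matrix_vector_mult_diff_rdistrib
            matrix_vector_mult_diff_distrib)
      show "E *v (pinv H *v (H *v v) + ((mat 1 - pinv H ** H) ** L) *v (W *v v)) = E *v v" for v
        by (simp add: LW matrix_vector_mul_assoc[symmetric] matrix_vector_mult_diff_rdistrib)
    qed
  next
    case False
    then obtain N' where N': "N' ** N = mat 1"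
      using nondeg invertible_left_inverse by blast
    have "E *v d = 0" if "H *v d = 0" for d
    proof -
      have "quad_form S (W *v d) = quad_form H d"
        by (simp only: H_def quad_form_congruence)
      then have "quad_form S (W *v d) = 0"
        using that by (simp add: quad_form_def)
      then have "quad_form N (E *v d) = 0"
        using dom[of d] psd_quad_form_nonneg[OF N, of "E *v d"] by simp
      then have "N' *v (N *v (E *v d)) = 0"
        using psd_mult_eq_0_if_quad_form_eq_0[OF N] by simp
      then show ?thesis by (metis matrix_vector_mul_assoc N' matrix_vector_mul_lid)
    qed
    from this[of "v - pinv H *v (H *v v)" for v] show thesis
      by (intro that[of 0]) (simp_all add: HHH matrix_vector_mult_diff_distrib)
  qed
  define F where "F = E ** (pinv H ** transpose W ** S + K)"
  have Fv: "F *v x = E *v (pinv H *v (transpose W *v (S *v x)) + K *v x)" for x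
    by (simp add: F_def matrix_vector_mult_add_rdistrib matrix_vector_mul_assoc[symmetric]
        del: transpose_matrix_vector)
  show thesis
  proof
    show "F ** W = E"
      using EK by (simp add: matrix_eq Fv H_def matrix_vector_mul_assoc[symmetric]
          del: transpose_matrix_vector)
    show "quad_form N (F *v x) \<le> quad_form S x" for x
      using dom[of "pinv H *v (transpose W *v (S *v x)) + K *v x"]
        quad_form_congruence_projection_le[OF S HK[unfolded H_def], of x x]
      by (simp add: Fv H_def)
  qed
qed

lemma invertible_uminus:
  fixes A :: "real^'n^'n"
  assumes "invertible A"
  shows "invertible (- A)"
proof -
  obtain B where "B ** A = mat 1" using assms invertible_left_inverse by blast
  moreover have "(- B) ** (- A) = B ** A"
    by (simp add: vec_eq_iff matrix_matrix_mult_def)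
  ultimately show ?thesis using invertible_left_inverse by metis
qed

theorem mainTheorem3:
  fixes P :: "real^('q::finite + 'r::finite)^('q + 'r)"
    and W :: "real^'p::finite^'q"
  assumes "P \<in> PiSet"
  shows "(\<lambda>Z. Z ** W) ` Zset P \<subseteq> Zset (PiW P W) \<and>
         ((rank W = CARD('p) \<or> invertible (blk22 P)) \<longrightarrow>
           (\<lambda>Z. Z ** W) ` Zset P = Zset (PiW P W))"
proof -
  let ?G = "pinv (blk22 P) ** blk21 P"
  have "(\<lambda>Z. Z ** W) ` Zset P \<subseteq> Zset (PiW P W)"
    using assms by (auto simp: Zset_iff_schur22 Zset_PiW_iff_schur22 matrix_vector_mul_assoc[symmetric])
  moreover have "Zset (PiW P W) \<subseteq> (\<lambda>Z. Z ** W) ` Zset P"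
    if nondeg: "rank W = CARD('p) \<or> invertible (blk22 P)"
  proof
    fix Y assume "Y \<in> Zset (PiW P W)"
    then have "quad_form (- blk22 P) ((Y + ?G ** W) *v v) \<le> quad_form (schur22 P) (W *v v)" for v
      using assms by (simp add: Zset_PiW_iff_schur22 matrix_vector_mult_add_rdistrib
          matrix_vector_mul_assoc[symmetric])
    moreover have "psd (- blk22 P)" "psd (schur22 P)"
      using assms by (simp_all add: PiSet_def nsd_def)
    ultimately obtain F where FW: "F ** W = Y + ?G ** W"
      and "\<And>x. quad_form (- blk22 P) (F *v x) \<le> quad_form (schur22 P) x"
      using psd_dominated_factor_extends nondeg invertible_uminus by metis
    then have "F - ?G \<in> Zset P"
      using assms by (simp add: Zset_iff_schur22 matrix_vector_mult_diff_rdistrib)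
    moreover have "(F - ?G) ** W = Y"
      using FW by (simp add: matrix_eq matrix_vector_mul_assoc[symmetric]
          matrix_vector_mult_diff_rdistrib matrix_vector_mult_add_rdistrib)
    ultimately show "Y \<in> (\<lambda>Z. Z ** W) ` Zset P" by blast
  qed
  ultimately show ?thesis by blast
qed

end
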